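(* Let $\mathbb{F}_q$ be the finite field with $q$ elements and let $n>0$ and $m>0$ be integers. Let $f,g\in\mathbb{F}_q[x,y]$ be random polynomials of the form $$f=c_nx^n+\sum_{i=0}^{n-1}\sum_{j=0}^{n-i}c_{ij}x^iy^j,\qquad g=d_mx^m+\sum_{i=0}^{m-1}\sum_{j=0}^{m-i}d_{ij}x^iy^j,$$ with $c_n,d_m,c_{ij},d_{ij}\in\mathbb{F}_q$, $c_n\neq 0$ and $d_m\neq 0$ (thus of total degree $n$ and $m$ respectively), where the pair $(f,g)$ is chosen uniformly at random among all pairs of polynomials of this form. Let $X$ be the random variable that counts the number of $\gamma\in\mathbb{F}_q$ such that $\gcd(f(x,\gamma),g(x,\gamma))\neq 1$ in $\mathbb{F}_q[x]$. Then: (a) $\mathrm{E}[X]=1$; and (b) $\mathrm{Var}[X]=1-1/q$.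
   Context: $\mathrm{E}[X]$ and $\mathrm{Var}[X]$ denote the expected value and variance of a random variable $X$. The gcd of two univariate polynomials over $\mathbb{F}_q$ is taken to be monic, so $\gcd\neq 1$ means the two polynomials are not coprime. *)

theory Defs
  imports
    "HOL-Probability.Probability"
    "HOL-Computational_Algebra.Computational_Algebra"
begin

text \<open>
  A polynomial in $x$ and $y$ over \<open>'a\<close> is an element of \<open>'a poly poly\<close>: the outer variable
  is $x$ and the coefficients are polynomials in $y$, so that \<open>monom (monom c j) i\<close> is the
  term $c x^i y^j$.
\<close>

definition x_regular_polys :: "nat \<Rightarrow> 'a::comm_ring_1 poly poly set" where
  "x_regular_polys n =
     {monom (monom a 0) n + (\<Sum>i<n. \<Sum>j\<le>n - i. monom (monom (c i j) j) i) | a c. a \<noteq> 0}"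

definition specialize_y :: "'a::comm_semiring_0 poly poly \<Rightarrow> 'a \<Rightarrow> 'a poly" where
  "specialize_y f \<gamma> = map_poly (\<lambda>p. poly p \<gamma>) f"

text \<open>
  The library's \<open>gcd\<close> on \<open>'a poly\<close> needs more type class structure on \<open>'a\<close> than \<open>field\<close>;
  \<open>coprime\<close> does not, and agrees with \<open>gcd = 1\<close> (\<open>coprime_iff_gcd_eq_1\<close>) whenever
  \<open>gcd\<close> is available.
\<close>

definition noncoprime_count :: "'a::field poly poly \<Rightarrow> 'a poly poly \<Rightarrow> nat" where
  "noncoprime_count f g = card {\<gamma>. \<not> coprime (specialize_y f \<gamma>) (specialize_y g \<gamma>)}"

text \<open>
  \<open>pmf_of_set\<close> is the uniform distribution only on finite nonempty sets; this is ensured by the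
  next two lemmas.
\<close>

definition random_pair :: "nat \<Rightarrow> nat \<Rightarrow> ('a::{field,finite} poly poly \<times> 'a poly poly) pmf" where
  "random_pair n m = pmf_of_set (x_regular_polys n \<times> x_regular_polys m)"

lemma x_regular_polys_nonempty: "x_regular_polys n \<noteq> ({} :: 'a::comm_ring_1 poly poly set)"
proof -
  have "monom (monom 1 0) n + (\<Sum>i<n. \<Sum>j\<le>n - i. monom (monom 0 j) i) \<in> (x_regular_polys n :: 'a poly poly set)"
    unfolding x_regular_polys_def
    by (rule CollectI, rule exI[of _ 1], rule exI[of _ "\<lambda>_ _. 0"]) simp
  then show ?thesis by blast
qed

lemma finite_x_regular_polys: "finite (x_regular_polys n :: 'a::{comm_ring_1,finite} poly poly set)"
proof -
  let ?C = "{..n} \<rightarrow>\<^sub>E ({..n} \<rightarrow>\<^sub>E (UNIV :: 'a set))"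
  let ?F = "\<lambda>(a, c). monom (monom a 0) n + (\<Sum>i<n. \<Sum>j\<le>n - i. monom (monom (c i j) j) i)"
  have "x_regular_polys n \<subseteq> ?F ` (UNIV \<times> ?C)"
  proof
    fix f :: "'a poly poly"
    assume "f \<in> x_regular_polys n"
    then obtain a c where f: "f = ?F (a, c)"
      by (auto simp: x_regular_polys_def)
    let ?c = "restrict (\<lambda>i. restrict (c i) {..n}) {..n}"
    have "f = ?F (a, ?c)"
      unfolding f by (auto intro!: sum.cong)
    moreover have "?c \<in> ?C" by auto
    ultimately show "f \<in> ?F ` (UNIV \<times> ?C)" by blast
  qed
  moreover have "finite (?F ` (UNIV \<times> ?C))"
    by (intro finite_imageI finite_cartesian_product finite_PiE) auto
  ultimately show ?thesis by (rule finite_subset)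
qed

end

theory Submission
  imports Defs
begin

text \<open>
  For each \<open>\<gamma>\<close>, specialising \<open>y\<close> to \<open>\<gamma>\<close> and dividing by the leading coefficient turns \<open>(f, g)\<close>
  into a uniformly random pair of monic polynomials of degrees \<open>n\<close> and \<open>m\<close>, and for
  \<open>\<gamma> \<noteq> \<delta>\<close> the two resulting pairs are independent: interpolation in \<open>y\<close> needs degree at most 1
  in \<open>y\<close>, which every non-leading coefficient is allowed to have. A random pair of monic
  polynomials of positive degrees is not coprime with probability \<open>1 / q\<close>. So \<open>X\<close> is a sum of
  \<open>q\<close> pairwise independent indicators of mean \<open>1 / q\<close>.

  The number \<open>N n m\<close> of non-coprime monic pairs is found by Euclid's algorithm: for
  \<open>m \<le> n\<close>, subtracting \<open>x ^ (n - m)\<close> times the second polynomial from the first gives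
  \<open>N n m = B n m\<close>, where \<open>B n m\<close> allows an arbitrary first polynomial of degree less than \<open>n\<close>,
  and splitting off the leading coefficient gives \<open>B (n + 1) m = B n m + (q - 1) * N n m\<close>.
\<close>

section \<open>Counting polynomials of bounded degree and monic polynomials\<close>

definition polys_below :: "nat \<Rightarrow> 'a::comm_ring_1 poly set" where
  "polys_below n = {p. \<forall>i\<ge>n. coeff p i = 0}"

definition monic_polys :: "nat \<Rightarrow> 'a::comm_ring_1 poly set" where
  "monic_polys n = {p. coeff p n = 1 \<and> (\<forall>i>n. coeff p i = 0)}"

lemma polys_below_Suc_pCons:
  "polys_below (Suc n) = (\<lambda>(a, p). pCons a p) ` (UNIV \<times> polys_below n)"
proof (intro equalityI subsetI)
  fix p :: "'a poly"
  assume p: "p \<in> polys_below (Suc n)"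
  obtain a r where "p = pCons a r" by (cases p)
  with p have "r \<in> polys_below n"
    by (auto simp: polys_below_def coeff_pCons split: nat.splits)
  with \<open>p = pCons a r\<close> show "p \<in> (\<lambda>(a, p). pCons a p) ` (UNIV \<times> polys_below n)" by force
qed (auto simp: polys_below_def coeff_pCons split: nat.splits)

lemma card_polys_below:
  "finite (polys_below n :: 'a::{comm_ring_1,finite} poly set)"
  "card (polys_below n :: 'a poly set) = CARD('a) ^ n"
proof (induction n)
  case 0
  \<comment> \<open>Vanishing coefficients, instead of a bound on \<open>degree\<close>, keep the
    zero polynomial in the set even for \<open>n = 0\<close>, so the count has no exception.\<close>
  have "polys_below 0 = {0 :: 'a poly}"
    by (auto simp: polys_below_def poly_eq_iff)
  then show "finite (polys_below 0 :: 'a poly set)" "card (polys_below 0 :: 'a poly set) = CARD('a) ^ 0"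
    by simp_all
next
  case (Suc n)
  have "inj_on (\<lambda>(a, p). pCons a p) (UNIV \<times> (polys_below n :: 'a poly set))"
    by (auto simp: inj_on_def)
  then show "finite (polys_below (Suc n) :: 'a poly set)"
    "card (polys_below (Suc n) :: 'a poly set) = CARD('a) ^ Suc n"
    using Suc by (simp_all add: polys_below_Suc_pCons card_image card_cartesian_product)
qed

text \<open>Two monic polynomials of degree \<open>n\<close> differ by a polynomial of degree below
  \<open>n\<close>, so the two sets are translates of each other.\<close>

lemma add_bij_betw_polys_below_monic_polys:
  assumes "p \<in> monic_polys n"
  shows "bij_betw (\<lambda>r. r + p) (polys_below n) (monic_polys n)"
  by (rule bij_betw_byWitness[where f' = "\<lambda>r. r - p"])
    (use assms in \<open>auto simp: polys_below_def monic_polys_def\<close>, metis le_neq_implies_less)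

lemma monom_in_monic_polys: "monom 1 n \<in> monic_polys n"
  by (auto simp: monic_polys_def)

lemma card_monic_polys:
  "finite (monic_polys n :: 'a::{comm_ring_1,finite} poly set)"
  "card (monic_polys n :: 'a poly set) = CARD('a) ^ n"
  using bij_betw_finite[OF add_bij_betw_polys_below_monic_polys[OF monom_in_monic_polys, where 'a = 'a]]
    bij_betw_same_card[OF add_bij_betw_polys_below_monic_polys[OF monom_in_monic_polys, where 'a = 'a]]
    card_polys_below[of n, where 'a = 'a] by metis+

section \<open>Coprimality under scaling and Euclidean steps\<close>

lemma coprime_smult_left_iff:
  fixes p r :: "'a::field poly"
  assumes "c \<noteq> 0"
  shows "coprime (smult c p) r \<longleftrightarrow> coprime p r"
  using assms by (simp add: coprime_def dvd_smult_iff)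

lemma coprime_smult_right_iff:
  fixes p r :: "'a::field poly"
  assumes "c \<noteq> 0"
  shows "coprime p (smult c r) \<longleftrightarrow> coprime p r"
  using assms by (simp add: coprime_def dvd_smult_iff)

text \<open>The common divisors stay the same: a divisor of \<open>r\<close> divides
  \<open>p + s * r\<close> exactly when it divides \<open>p\<close>.\<close>

lemma coprime_add_mult_left_iff:
  fixes p r s :: "'a::field poly"
  shows "coprime (p + s * r) r \<longleftrightarrow> coprime p r"
proof -
  have "d dvd p + s * r \<longleftrightarrow> d dvd p" if "d dvd r" for d
    using that by (simp add: dvd_add_left_iff)
  then show ?thesis unfolding coprime_def by blast
qed

section \<open>Counting non-coprime pairs by Euclid's algorithm\<close>

definition noncoprime_below :: "nat \<Rightarrow> nat \<Rightarrow> ('a::field poly \<times> 'a poly) set" where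
  "noncoprime_below n m = {(p, r) \<in> polys_below n \<times> monic_polys m. \<not> coprime p r}"

definition noncoprime_monic :: "nat \<Rightarrow> nat \<Rightarrow> ('a::field poly \<times> 'a poly) set" where
  "noncoprime_monic n m = {(p, r) \<in> monic_polys n \<times> monic_polys m. \<not> coprime p r}"

lemma finite_noncoprime_below: "finite (noncoprime_below n m :: ('a::{field,finite} poly \<times> 'a poly) set)"
  unfolding noncoprime_below_def
  by (rule finite_subset[where B = "polys_below n \<times> monic_polys m"])
    (auto simp: card_polys_below card_monic_polys)

lemma finite_noncoprime_monic: "finite (noncoprime_monic n m :: ('a::{field,finite} poly \<times> 'a poly) set)"
  unfolding noncoprime_monic_def
  by (rule finite_subset[where B = "monic_polys n \<times> monic_polys m"])
    (auto simp: card_monic_polys)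

lemma card_noncoprime_monic_sym:
  "card (noncoprime_monic n m :: ('a::field poly \<times> 'a poly) set) =
    card (noncoprime_monic m n :: ('a poly \<times> 'a poly) set)"
  by (rule bij_betw_same_card[of prod.swap], rule bij_betw_byWitness[where f' = prod.swap])
    (auto simp: noncoprime_monic_def coprime_commute)

text \<open>Since \<open>m \<le> n\<close>, the product \<open>monom 1 (n - m) * r\<close> is monic
  of degree \<open>n\<close> for each \<open>r\<close> in \<open>monic_polys m\<close>. Adding it to
  \<open>p\<close> is therefore a bijection for each fixed \<open>r\<close>, and coprimality with
  \<open>r\<close> is preserved.\<close>

lemma card_noncoprime_monic_eq_below:
  assumes "m \<le> n"
  shows "card (noncoprime_monic n m :: ('a::field poly \<times> 'a poly) set) =
    card (noncoprime_below n m :: ('a poly \<times> 'a poly) set)"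
proof -
  have s: "monom 1 (n - m) * r \<in> monic_polys n" if "r \<in> monic_polys m" for r :: "'a poly"
    using that assms by (auto simp: monic_polys_def coeff_monom_mult)
  have plus: "p + monom 1 (n - m) * r \<in> monic_polys n"
    if "p \<in> polys_below n" "r \<in> monic_polys m" for p r :: "'a poly"
    using that s[of r] by (auto simp: polys_below_def monic_polys_def)
  have minus: "p - monom 1 (n - m) * r \<in> polys_below n"
    if "p \<in> monic_polys n" "r \<in> monic_polys m" for p r :: "'a poly"
    using that s[of r] by (auto simp: polys_below_def monic_polys_def) (metis le_neq_implies_less)
  have cop: "coprime (p - monom 1 (n - m) * r) r \<longleftrightarrow> coprime p r" for p r :: "'a poly"
    using coprime_add_mult_left_iff[of p "- monom 1 (n - m)" r] by simp
  show ?thesis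
    by (rule sym, rule bij_betw_same_card[of "\<lambda>(p, r). (p + monom 1 (n - m) * r, r)"],
        rule bij_betw_byWitness[where f' = "\<lambda>(p, r). (p - monom 1 (n - m) * r, r)"])
      (auto simp: noncoprime_below_def noncoprime_monic_def coprime_add_mult_left_iff cop plus minus)
qed

lemma smult_in_polys_below_Suc:
  "p \<in> monic_polys n \<Longrightarrow> smult c p \<in> polys_below (Suc n)"
  by (auto simp: polys_below_def monic_polys_def)

text \<open>A polynomial of degree at most \<open>n\<close> either has coefficient 0 at
  \<open>x ^ n\<close> or is a nonzero scalar times a monic polynomial of degree \<open>n\<close>.
  The scalar is determined as the leading coefficient and does not affect coprimality.\<close>

lemma card_noncoprime_below_Suc:
  "card (noncoprime_below (Suc n) m :: ('a::{field,finite} poly \<times> 'a poly) set) =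
    card (noncoprime_below n m :: ('a poly \<times> 'a poly) set) +
    (CARD('a) - 1) * card (noncoprime_monic n m :: ('a poly \<times> 'a poly) set)"
proof -
  let ?h = "\<lambda>(c :: 'a, (p, r)). (smult c p, r)"
  let ?D = "(- {0 :: 'a}) \<times> (noncoprime_monic n m :: ('a poly \<times> 'a poly) set)"
  have "noncoprime_below (Suc n) m = noncoprime_below n m \<union> ?h ` ?D"
  proof (intro equalityI subsetI)
    fix x :: "'a poly \<times> 'a poly"
    assume "x \<in> noncoprime_below (Suc n) m"
    then obtain p r where x: "x = (p, r)" and p: "p \<in> polys_below (Suc n)"
      and r: "r \<in> monic_polys m" and nc: "\<not> coprime p r"
      by (auto simp: noncoprime_below_def)
    show "x \<in> noncoprime_below n m \<union> ?h ` ?D"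
    proof (cases "coeff p n = 0")
      case True
      then have "p \<in> polys_below n"
        using p by (auto simp: polys_below_def) (metis le_antisym not_less_eq_eq)
      then show ?thesis using r nc x by (auto simp: noncoprime_below_def)
    next
      case False
      then have "smult (inverse (coeff p n)) p \<in> monic_polys n"
        using p by (auto simp: polys_below_def monic_polys_def)
      then have "(coeff p n, (smult (inverse (coeff p n)) p, r)) \<in> ?D"
        using False r nc by (auto simp: noncoprime_monic_def coprime_smult_left_iff)
      moreover have "x = ?h (coeff p n, (smult (inverse (coeff p n)) p, r))"
        using False x by simp
      ultimately show ?thesis by blast
    qed
  qed (auto simp: noncoprime_below_def noncoprime_monic_def coprime_smult_left_iff
        smult_in_polys_below_Suc polys_below_def[of n] polys_below_def[of "Suc n"] monic_polys_def[of n])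
  moreover have "noncoprime_below n m \<inter> ?h ` ?D = {}"
    by (auto simp: noncoprime_below_def noncoprime_monic_def polys_below_def monic_polys_def)
  moreover have "inj_on ?h ?D"
  proof -
    have "(c, (p, r)) = (d, (s, t))"
      if "(c, (p, r)) \<in> ?D" "(d, (s, t)) \<in> ?D" and eq: "(smult c p, r) = (smult d s, t)"
      for c d and p r s t :: "'a poly"
    proof -
      have monic: "coeff p n = 1" "coeff s n = 1" and "c \<noteq> 0"
        using that(1,2) by (auto simp: noncoprime_monic_def monic_polys_def)
      have "c * coeff p n = d * coeff s n"
        using arg_cong[OF eq, of "\<lambda>(p, r). coeff p n"] by simp
      then have "c = d" using monic by simp
      with eq \<open>c \<noteq> 0\<close> show ?thesis by (auto simp: poly_eq_iff)
    qed
    then show ?thesis by (intro inj_onI) (simp only: split_paired_all prod.case)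
  qed
  moreover have "card (- {0 :: 'a}) = CARD('a) - 1"
    by (simp add: Compl_eq_Diff_UNIV card_Diff_singleton)
  ultimately show ?thesis
    by (simp add: card_Un_disjoint finite_noncoprime_below finite_noncoprime_monic card_image
        card_cartesian_product)
qed

text \<open>Everything divides 0, so this makes 0 non-coprime to each monic polynomial of positive
  degree, which starts the recursion.\<close>

lemma not_is_unit_monic:
  fixes r :: "'a::field poly"
  assumes "r \<in> monic_polys m" "0 < m"
  shows "\<not> is_unit r"
proof
  assume "is_unit r"
  then have "degree r = 0" by (auto simp: is_unit_poly_iff)
  moreover have "m \<le> degree r" using assms by (intro le_degree) (simp add: monic_polys_def)
  ultimately show False using assms by simp
qed

lemma monic_polys_0: "monic_polys 0 = {1}"
  by (auto simp: monic_polys_def poly_eq_iff coeff_1)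

lemma noncoprime_monic_0: "noncoprime_monic 0 m = {}"
  by (auto simp: noncoprime_monic_def monic_polys_0)

lemma card_noncoprime_below_0:
  assumes "0 < m"
  shows "card (noncoprime_below 0 m :: ('a::{field,finite} poly \<times> 'a poly) set) = CARD('a) ^ m"
proof -
  have "polys_below 0 = {0 :: 'a poly}"
    by (auto simp: polys_below_def poly_eq_iff)
  then have "noncoprime_below 0 m = {0 :: 'a poly} \<times> monic_polys m"
    using not_is_unit_monic[OF _ assms, where 'a = 'a]
    by (auto simp: noncoprime_below_def)
  then show ?thesis by (simp add: card_cartesian_product card_monic_polys)
qed

lemma card_field_gt_1: "1 < CARD('a::{field,finite})"
  using card_mono[of "UNIV :: 'a set" "{0, 1}"] by simp

text \<open>Strong induction on \<open>n + m\<close>. An inner induction climbs from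
  \<open>B 1 b\<close> to \<open>B a b = N a b\<close>; each of its steps uses some
  \<open>N k b\<close> with \<open>k < a\<close>, hence with a smaller sum.\<close>

lemma card_noncoprime_monic:
  assumes "0 < n" "0 < m"
  shows "card (noncoprime_monic n m :: ('a::{field,finite} poly \<times> 'a poly) set) = CARD('a) ^ (n + m - 1)"
  using assms
proof (induction "n + m" arbitrary: n m rule: less_induct)
  case (less n m)
  let ?N = "\<lambda>n m. card (noncoprime_monic n m :: ('a poly \<times> 'a poly) set)"
  let ?B = "\<lambda>n m. card (noncoprime_below n m :: ('a poly \<times> 'a poly) set)"
  \<comment> \<open>Only the sum of \<open>a\<close> and \<open>b\<close> is tied to
    \<open>n\<close> and \<open>m\<close>, so that the claim also serves the swapped pair.\<close>
  have main: "?N a b = CARD('a) ^ (a + b - 1)" if "a + b = n + m" "0 < b" "b \<le> a" for a b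
  proof -
    have "?B (Suc k) b = CARD('a) ^ (k + b)" if "k < a" for k
      using that
    proof (induction k)
      \<comment> \<open>Nonzero constants are coprime to everything, so
        \<open>B 1 b = B 0 b\<close>. The growth by a factor \<open>q\<close> starts only after
        that, hence the claim about \<open>Suc k\<close>.\<close>
      case 0
      show ?case
        using \<open>0 < b\<close> by (simp add: card_noncoprime_below_Suc noncoprime_monic_0 card_noncoprime_below_0)
    next
      case (Suc k)
      have "?N (Suc k) b = CARD('a) ^ (Suc k + b - 1)"
        by (rule less.hyps) (use Suc.prems that \<open>a + b = n + m\<close> \<open>0 < b\<close> in auto)
      moreover have "?B (Suc k) b = CARD('a) ^ (k + b)" using Suc by simp
      moreover have "CARD('a) ^ (k + b) + (CARD('a) - 1) * CARD('a) ^ (k + b) = CARD('a) ^ (Suc k + b)"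
        using card_field_gt_1[where 'a = 'a] by (cases "CARD('a)") auto
      ultimately show ?case using card_noncoprime_below_Suc[of "Suc k" b, where 'a = 'a] by simp
    qed
    from this[of "a - 1"] show ?thesis
      using that card_noncoprime_monic_eq_below[of b a, where 'a = 'a] by simp
  qed
  show ?case
  proof (cases "m \<le> n")
    case True
    then show ?thesis using main[of n m] less.prems by simp
  next
    case False
    then show ?thesis
      using main[of m n] less.prems card_noncoprime_monic_sym[of n m, where 'a = 'a]
      by (simp add: add.commute)
  qed
qed

section \<open>Coefficientwise description of the random polynomials\<close>

lemma x_regular_polys_iff:
  fixes f :: "'a::comm_ring_1 poly poly"
  shows "f \<in> x_regular_polys n \<longleftrightarrow>
    (\<exists>a. a \<noteq> 0 \<and> coeff f n = [:a:]) \<and> (\<forall>i<n. degree (coeff f i) \<le> n - i) \<and> (\<forall>i>n. coeff f i = 0)"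
    (is "_ \<longleftrightarrow> ?rhs")
proof
  assume "f \<in> x_regular_polys n"
  then obtain a c where "a \<noteq> 0"
    and f: "f = monom (monom a 0) n + (\<Sum>i<n. \<Sum>j\<le>n - i. monom (monom (c i j) j) i)"
    by (auto simp: x_regular_polys_def)
  have coeff_f: "coeff f k = (if k = n then [:a:] else if k < n then \<Sum>j\<le>n - k. monom (c k j) j else 0)" for k
  proof -
    have "f = monom [:a:] n + (\<Sum>i<n. monom (\<Sum>j\<le>n - i. monom (c i j) j) i)"
      by (simp add: f monom_sum monom_0)
    also have "coeff \<dots> k = (if k = n then [:a:] else 0) +
        (\<Sum>i<n. if i = k then \<Sum>j\<le>n - i. monom (c i j) j else 0)"
      by (simp only: coeff_add coeff_sum[of _ "{..<n}"] coeff_monom eq_commute[of k])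
    also have "\<dots> = (if k = n then [:a:] else if k < n then \<Sum>j\<le>n - k. monom (c k j) j else 0)"
      by (subst sum.delta) auto
    finally show ?thesis .
  qed
  have "degree (\<Sum>j\<le>n - i. monom (c i j) j) \<le> n - i" for i
    by (intro degree_sum_le) (auto intro: order_trans[OF degree_monom_le])
  then show ?rhs using \<open>a \<noteq> 0\<close> by (auto simp: coeff_f)
next
  assume rhs: ?rhs
  then obtain a where a: "a \<noteq> 0" "coeff f n = [:a:]" by blast
  let ?c = "\<lambda>i j. coeff (coeff f i) j"
  have "f = (\<Sum>i\<le>n. monom (coeff f i) i)"
    using rhs by (intro poly_as_sum_of_monoms'[symmetric] degree_le) auto
  also have "\<dots> = (\<Sum>i<n. monom (coeff f i) i) + monom (monom a 0) n"
    using a by (simp add: lessThan_Suc_atMost[symmetric] monom_0)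
  also have "(\<Sum>i<n. monom (coeff f i) i) = (\<Sum>i<n. \<Sum>j\<le>n - i. monom (monom (?c i j) j) i)"
  proof (rule sum.cong)
    fix i assume "i \<in> {..<n}"
    then have "coeff f i = (\<Sum>j\<le>n - i. monom (?c i j) j)"
      using rhs by (intro poly_as_sum_of_monoms'[symmetric]) auto
    then show "monom (coeff f i) i = (\<Sum>j\<le>n - i. monom (monom (?c i j) j) i)"
      by (simp flip: monom_sum)
  qed simp
  finally show "f \<in> x_regular_polys n"
    unfolding x_regular_polys_def using a by (auto simp: add.commute)
qed

section \<open>Specialisation of \<open>y\<close> and interpolation between two points\<close>

lemma coeff_specialize_y [simp]: "coeff (specialize_y f \<gamma>) i = poly (coeff f i) \<gamma>"
  by (simp add: specialize_y_def coeff_map_poly)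

lemma specialize_y_add: "specialize_y (f + g) \<gamma> = specialize_y f \<gamma> + specialize_y g \<gamma>"
  by (simp add: poly_eq_iff)

lemma specialize_y_diff:
  "specialize_y (f - g) \<gamma> = specialize_y f \<gamma> - specialize_y (g :: 'a::comm_ring_1 poly poly) \<gamma>"
  by (simp add: poly_eq_iff)

lemma specialize_y_smult: "specialize_y (smult p f) \<gamma> = smult (poly p \<gamma>) (specialize_y f \<gamma>)"
  by (simp add: poly_eq_iff)

text \<open>The Lagrange basis polynomial of \<open>\<gamma>\<close> for the two nodes
  \<open>\<gamma>\<close> and \<open>\<delta>\<close>.\<close>

definition switch_poly :: "'a::field \<Rightarrow> 'a \<Rightarrow> 'a poly" where
  "switch_poly \<gamma> \<delta> = smult (inverse (\<gamma> - \<delta>)) [:- \<delta>, 1:]"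

lemma poly_switch_poly:
  assumes "\<gamma> \<noteq> \<delta>"
  shows "poly (switch_poly \<gamma> \<delta>) \<gamma> = 1" "poly (switch_poly \<gamma> \<delta>) \<delta> = 0"
proof -
  have "poly (switch_poly \<gamma> \<delta>) x = inverse (\<gamma> - \<delta>) * (x - \<delta>)" for x
    unfolding switch_poly_def poly_smult by simp
  then show "poly (switch_poly \<gamma> \<delta>) \<gamma> = 1" "poly (switch_poly \<gamma> \<delta>) \<delta> = 0"
    using assms by simp_all
qed

text \<open>Lagrange interpolation written as \<open>v\<close> plus a multiple of
  \<open>u - v\<close>: coefficients on which \<open>u\<close> and \<open>v\<close> agree stay
  constant in \<open>y\<close>, in particular the leading 1 of two monic polynomials.\<close>

definition interpolate :: "'a::field \<Rightarrow> 'a \<Rightarrow> 'a poly \<times> 'a poly \<Rightarrow> 'a poly poly" where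
  "interpolate \<gamma> \<delta> = (\<lambda>(u, v). map_poly (\<lambda>c. [:c:]) v +
     smult (switch_poly \<gamma> \<delta>) (map_poly (\<lambda>c. [:c:]) (u - v)))"

lemma coeff_interpolate:
  "coeff (interpolate \<gamma> \<delta> (u, v)) i = [:coeff v i:] + switch_poly \<gamma> \<delta> * [:coeff u i - coeff v i:]"
  by (simp add: interpolate_def coeff_map_poly)

text \<open>Degree 1 in \<open>y\<close> is admissible in the coefficient of \<open>x ^ i\<close>
  for every \<open>i < n\<close>, because \<open>n - i\<close> is then at least 1.\<close>

lemma degree_coeff_interpolate: "degree (coeff (interpolate \<gamma> \<delta> uv) i) \<le> 1"
proof -
  have "degree (switch_poly \<gamma> \<delta>) \<le> 1" by (simp add: switch_poly_def)
  then show ?thesis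
    by (cases uv) (simp add: coeff_interpolate degree_add_le order_trans[OF degree_smult_le])
qed

lemma coeff_interpolate_monic:
  assumes "u \<in> monic_polys n" "v \<in> monic_polys n"
  shows "coeff (interpolate \<gamma> \<delta> (u, v)) n = 1"
    and "n < i \<Longrightarrow> coeff (interpolate \<gamma> \<delta> (u, v)) i = 0"
  using assms by (simp_all add: coeff_interpolate monic_polys_def one_pCons)

lemma specialize_y_interpolate:
  assumes "\<gamma> \<noteq> \<delta>"
  shows "specialize_y (interpolate \<gamma> \<delta> (u, v)) \<gamma> = u"
    and "specialize_y (interpolate \<gamma> \<delta> (u, v)) \<delta> = v"
  by (simp_all add: poly_eq_iff coeff_interpolate poly_switch_poly[OF assms])

section \<open>Decomposition by the specialisations at two points\<close>

definition vanishing_polys :: "nat \<Rightarrow> 'a::field \<Rightarrow> 'a \<Rightarrow> 'a poly poly set" where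
  "vanishing_polys n \<gamma> \<delta> =
     {h. (\<forall>i<n. degree (coeff h i) \<le> n - i) \<and> (\<forall>i\<ge>n. coeff h i = 0) \<and>
         specialize_y h \<gamma> = 0 \<and> specialize_y h \<delta> = 0}"

text \<open>The pair \<open>uv\<close> holds the two specialisations made monic. The leading
  coefficient \<open>a\<close> and the remainder \<open>h\<close> are grouped apart, as they are the
  freedom that coprimality does not see.\<close>

definition from_parts :: "'a::field \<Rightarrow> 'a \<Rightarrow> ('a \<times> 'a poly poly) \<times> ('a poly \<times> 'a poly) \<Rightarrow> 'a poly poly" where
  "from_parts \<gamma> \<delta> = (\<lambda>((a, h), uv). smult [:a:] (interpolate \<gamma> \<delta> uv) + h)"

abbreviation parts :: "nat \<Rightarrow> 'a::field \<Rightarrow> 'a \<Rightarrow> (('a \<times> 'a poly poly) \<times> ('a poly \<times> 'a poly)) set" where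
  "parts n \<gamma> \<delta> \<equiv> ((- {0 :: 'a}) \<times> vanishing_polys n \<gamma> \<delta>) \<times> (monic_polys n \<times> monic_polys n)"

lemma specialize_y_from_parts:
  assumes "\<gamma> \<noteq> \<delta>" "h \<in> vanishing_polys n \<gamma> \<delta>"
  shows "specialize_y (from_parts \<gamma> \<delta> ((a, h), (u, v))) \<gamma> = smult a u"
    and "specialize_y (from_parts \<gamma> \<delta> ((a, h), (u, v))) \<delta> = smult a v"
  using assms
  by (simp_all add: from_parts_def specialize_y_add specialize_y_smult specialize_y_interpolate
      vanishing_polys_def)

text \<open>The inverse reads off \<open>a\<close> as the leading coefficient, divides both
  specialisations by it, and takes for \<open>h\<close> what is left after subtracting the scaled
  interpolant.\<close>

lemma bij_betw_from_parts:
  fixes \<gamma> \<delta> :: "'a::field"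
  assumes "\<gamma> \<noteq> \<delta>"
  shows "bij_betw (from_parts \<gamma> \<delta>) (parts n \<gamma> \<delta>) (x_regular_polys n)"
proof -
  \<comment> \<open>For the polynomials in question the coefficient of \<open>x ^ n\<close> is
    constant in \<open>y\<close>, so its constant term is all of it.\<close>
  let ?a = "\<lambda>f :: 'a poly poly. coeff (coeff f n) 0"
  let ?uv = "\<lambda>f :: 'a poly poly. (smult (inverse (?a f)) (specialize_y f \<gamma>),
    smult (inverse (?a f)) (specialize_y f \<delta>))"
  let ?h = "\<lambda>f :: 'a poly poly. f - smult [:?a f:] (interpolate \<gamma> \<delta> (?uv f))"
  let ?g = "\<lambda>f. ((?a f, ?h f), ?uv f)"
  have deg: "degree (coeff (smult [:c:] (interpolate \<gamma> \<delta> uv)) i) \<le> n - i" if "i < n" for c uv i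
    using that degree_coeff_interpolate[of \<gamma> \<delta> uv i]
    by (intro order_trans[OF _ Suc_leI[OF zero_less_diff[THEN iffD2, OF that]]])
      (simp add: order_trans[OF degree_smult_le])
  have coeffs: "coeff (from_parts \<gamma> \<delta> x) n = [:fst (fst x):]"
    "n < i \<Longrightarrow> coeff (from_parts \<gamma> \<delta> x) i = 0" if "x \<in> parts n \<gamma> \<delta>" for x i
    using that by (auto simp: from_parts_def coeff_interpolate_monic vanishing_polys_def)
  have left: "?g (from_parts \<gamma> \<delta> x) = x" if x: "x \<in> parts n \<gamma> \<delta>" for x
  proof -
    obtain a h u v where x': "x = ((a, h), (u, v))" by (metis prod.collapse)
    have a: "a \<noteq> 0" "h \<in> vanishing_polys n \<gamma> \<delta>" using x x' by auto
    have "?a (from_parts \<gamma> \<delta> x) = a" using coeffs(1)[OF x] by (simp add: x')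
    moreover from this have "?uv (from_parts \<gamma> \<delta> x) = (u, v)"
      using a by (simp add: specialize_y_from_parts[OF assms a(2)] x')
    ultimately show ?thesis by (simp add: x') (simp add: from_parts_def)
  qed
  have into: "from_parts \<gamma> \<delta> x \<in> x_regular_polys n" if x: "x \<in> parts n \<gamma> \<delta>" for x
  proof -
    have "degree (coeff (from_parts \<gamma> \<delta> x) i) \<le> n - i" if "i < n" for i
      using x that
      by (auto simp: from_parts_def vanishing_polys_def simp del: coeff_smult intro!: degree_add_le deg)
    then show ?thesis using coeffs[OF x] x by (auto simp: x_regular_polys_iff)
  qed
  have right: "from_parts \<gamma> \<delta> (?g f) = f" for f
    by (simp add: from_parts_def)
  have parts_mem: "?g f \<in> parts n \<gamma> \<delta>" if f: "f \<in> x_regular_polys n" for f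
  proof -
    obtain a where a: "a \<noteq> 0" "coeff f n = [:a:]" using f by (auto simp: x_regular_polys_iff)
    define u where "u = smult (inverse a) (specialize_y f \<gamma>)"
    define v where "v = smult (inverse a) (specialize_y f \<delta>)"
    define h where "h = f - smult [:a:] (interpolate \<gamma> \<delta> (u, v))"
    have uv: "u \<in> monic_polys n" "v \<in> monic_polys n"
      using f a by (auto simp: u_def v_def monic_polys_def x_regular_polys_iff)
    have "degree (coeff h i) \<le> n - i" if "i < n" for i
      unfolding h_def coeff_diff using f that by (intro degree_diff_le deg) (auto simp: x_regular_polys_iff)
    \<comment> \<open>At \<open>i = n\<close> the leading coefficient of \<open>f\<close> cancels
      against \<open>a\<close> times the leading 1 of the interpolant.\<close>
    moreover have "coeff h i = 0" if "n \<le> i" for i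
      using that f a coeff_interpolate_monic[OF uv, where \<gamma> = \<gamma> and \<delta> = \<delta>]
      by (cases "i = n") (auto simp: h_def x_regular_polys_iff)
    moreover have "specialize_y h \<gamma> = 0" "specialize_y h \<delta> = 0"
      using a by (simp_all add: h_def specialize_y_diff specialize_y_smult
          specialize_y_interpolate[OF assms] u_def v_def)
    ultimately have "h \<in> vanishing_polys n \<gamma> \<delta>" by (simp add: vanishing_polys_def)
    moreover have g: "?g f = ((a, h), (u, v))" by (simp add: h_def u_def v_def a)
    ultimately show ?thesis unfolding g using a uv by simp
  qed
  show ?thesis
    by (rule bij_betw_byWitness[where f' = ?g]) (use left into right parts_mem in blast)+
qed

text \<open>By scale invariance \<open>P\<close> and \<open>Q\<close> see only the monic parts,
  which the decomposition lets vary freely. One factor is free of both conditions and the others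
  involve one condition each: this is the independence at \<open>\<gamma>\<close> and
  \<open>\<delta>\<close>.\<close>

lemma card_x_regular_pairs_specialize:
  fixes \<gamma> \<delta> :: "'a::{field,finite}"
  assumes "\<gamma> \<noteq> \<delta>"
    and P: "\<And>a b u s. a \<noteq> 0 \<Longrightarrow> b \<noteq> 0 \<Longrightarrow> P (smult a u) (smult b s) \<longleftrightarrow> P u s"
    and Q: "\<And>a b u s. a \<noteq> 0 \<Longrightarrow> b \<noteq> 0 \<Longrightarrow> Q (smult a u) (smult b s) \<longleftrightarrow> Q u s"
  shows "card {(f, g) \<in> x_regular_polys n \<times> x_regular_polys m.
      P (specialize_y f \<gamma>) (specialize_y g \<gamma>) \<and> Q (specialize_y f \<delta>) (specialize_y g \<delta>)} =
    card (((- {0 :: 'a}) \<times> vanishing_polys n \<gamma> \<delta>) \<times> ((- {0 :: 'a}) \<times> vanishing_polys m \<gamma> \<delta>)) *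
    card {(u, s) \<in> monic_polys n \<times> monic_polys m. P u s} *
    card {(u, s) \<in> monic_polys n \<times> monic_polys m. Q u s}"
proof -
  let ?W = "((- {0 :: 'a}) \<times> vanishing_polys n \<gamma> \<delta>) \<times> ((- {0 :: 'a}) \<times> vanishing_polys m \<gamma> \<delta>)"
  let ?A = "{(u, s) \<in> monic_polys n \<times> monic_polys m. P u s}"
  let ?B = "{(u, s) \<in> monic_polys n \<times> monic_polys m. Q u s}"
  let ?E = "{(f, g) \<in> x_regular_polys n \<times> x_regular_polys m.
      P (specialize_y f \<gamma>) (specialize_y g \<gamma>) \<and> Q (specialize_y f \<delta>) (specialize_y g \<delta>)}"
  \<comment> \<open>A transposition: conditions pair the monic parts by point, as
    \<open>(u, s)\<close> and \<open>(v, t)\<close>, whereas \<open>from_parts\<close> needs them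
    paired by polynomial.\<close>
  let ?h = "\<lambda>((w, w'), (u, s), (v, t)). (from_parts \<gamma> \<delta> (w, (u, v)), from_parts \<gamma> \<delta> (w', (s, t)))"
  note bij = bij_betw_from_parts[OF assms(1)]
  have "bij_betw ?h (?W \<times> ?A \<times> ?B) ?E"
  proof (rule bij_betw_imageI)
    have "inj_on (from_parts \<gamma> \<delta>) (parts k \<gamma> \<delta>)" for k
      using bij by (rule bij_betw_imp_inj_on)
    note inj = inj_onD[OF this]
    show "inj_on ?h (?W \<times> ?A \<times> ?B)"
    proof (rule inj_onI)
      fix x y
      assume xy: "x \<in> ?W \<times> ?A \<times> ?B" "y \<in> ?W \<times> ?A \<times> ?B" "?h x = ?h y"
      obtain w w' u s v t where x: "x = ((w, w'), (u, s), (v, t))" by (metis prod.collapse)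
      obtain z z' c d e k where y: "y = ((z, z'), (c, d), (e, k))" by (metis prod.collapse)
      have "(w, (u, v)) = (z, (c, e))"
        by (rule inj[of _ _ n]) (use xy in \<open>auto simp: x y\<close>)
      moreover have "(w', (s, t)) = (z', (d, k))"
        by (rule inj[of _ _ m]) (use xy in \<open>auto simp: x y\<close>)
      ultimately show "x = y" by (simp add: x y)
    qed
    show "?h ` (?W \<times> ?A \<times> ?B) = ?E"
    proof (intro equalityI subsetI)
      fix x assume "x \<in> ?h ` (?W \<times> ?A \<times> ?B)"
      then show "x \<in> ?E"
        using bij_betwE[OF bij, of n] bij_betwE[OF bij, of m]
        by (auto simp: specialize_y_from_parts[OF assms(1)] P Q)
    next
      fix x assume x: "x \<in> ?E"
      then obtain f g where fg: "x = (f, g)" "f \<in> x_regular_polys n" "g \<in> x_regular_polys m" by auto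
      from fg(2) obtain y where y: "y \<in> parts n \<gamma> \<delta>" "f = from_parts \<gamma> \<delta> y"
        using bij_betw_imp_surj_on[OF bij, of n] by blast
      from fg(3) obtain z where z: "z \<in> parts m \<gamma> \<delta>" "g = from_parts \<gamma> \<delta> z"
        using bij_betw_imp_surj_on[OF bij, of m] by blast
      obtain a h u v where y': "y = ((a, h), (u, v))" by (metis prod.collapse)
      obtain b k s t where z': "z = ((b, k), (s, t))" by (metis prod.collapse)
      have "(((a, h), (b, k)), (u, s), (v, t)) \<in> ?W \<times> ?A \<times> ?B"
        using x y z fg by (auto simp: y' z' specialize_y_from_parts[OF assms(1)] P Q)
      moreover have "x = ?h (((a, h), (b, k)), (u, s), (v, t))"
        using fg y z y' z' by simp
      ultimately show "x \<in> ?h ` (?W \<times> ?A \<times> ?B)" by blast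
    qed
  qed
  then have "card ?E = card (?W \<times> ?A \<times> ?B)" by (rule bij_betw_same_card[symmetric])
  then show ?thesis by (simp only: card_cartesian_product mult.assoc)
qed

section \<open>Probabilities at one and at two points\<close>

definition noncoprime_at :: "'a::field \<Rightarrow> ('a poly poly \<times> 'a poly poly) set" where
  "noncoprime_at \<gamma> = {(f, g). \<not> coprime (specialize_y f \<gamma>) (specialize_y g \<gamma>)}"

text \<open>All counts come from the two-point formula, with the condition \<open>True\<close> where
  nothing is imposed. They are \<open>w * (q * t) ^ 2\<close> for the whole space,
  \<open>w * t * (q * t)\<close> for one point and \<open>w * t * t\<close> for two.\<close>

lemma prob_noncoprime_at:
  fixes \<gamma> \<delta> :: "'a::{field,finite}"
  assumes pos: "0 < n" "0 < m" and neq: "\<gamma> \<noteq> \<delta>"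
  shows "measure_pmf.prob (random_pair n m) (noncoprime_at \<gamma>) = 1 / real CARD('a)"
    and "measure_pmf.prob (random_pair n m) (noncoprime_at \<gamma> \<inter> noncoprime_at \<delta>) = 1 / real CARD('a) ^ 2"
proof -
  let ?R = "(x_regular_polys n :: 'a poly poly set) \<times> (x_regular_polys m :: 'a poly poly set)"
  let ?W = "((- {0 :: 'a}) \<times> vanishing_polys n \<gamma> \<delta>) \<times> ((- {0 :: 'a}) \<times> vanishing_polys m \<gamma> \<delta>)"
  let ?nc = "\<lambda>u s :: 'a poly. \<not> coprime u s"
  let ?q = "real CARD('a)"
  have R: "finite ?R" "?R \<noteq> {}"
    by (simp_all add: finite_x_regular_polys x_regular_polys_nonempty)
  have prob: "measure_pmf.prob (random_pair n m) S = real (card (?R \<inter> S)) / real (card ?R)" for S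
    unfolding random_pair_def by (rule measure_pmf_of_set[OF R(2,1)])
  note c = card_x_regular_pairs_specialize[OF neq, where n = n and m = m]
  have all: "card {(u, s) \<in> (monic_polys n :: 'a poly set) \<times> (monic_polys m :: 'a poly set). True} = CARD('a) ^ (n + m)"
    by (simp add: card_cartesian_product card_monic_polys power_add split_def mem_Times_iff[symmetric])
  have nc: "card {(u, s) \<in> monic_polys n \<times> monic_polys m. ?nc u s} = CARD('a) ^ (n + m - 1)"
    using card_noncoprime_monic[OF pos, where 'a = 'a] by (simp only: noncoprime_monic_def)
  \<comment> \<open>\<open>t\<close> is the number of non-coprime monic pairs. As
    \<open>n + m\<close> is positive, the exponent does not truncate and there are
    \<open>q * t\<close> monic pairs in all.\<close>
  define w t where "w = card ?W" and "t = CARD('a) ^ (n + m - 1)"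
  have all': "CARD('a) ^ (n + m) = CARD('a) * t"
    using pos unfolding t_def by (cases "n + m") auto
  note c = c[folded w_def] and nc = nc[folded t_def] and all = all[unfolded all']
  have R_eq: "{(f, g) \<in> ?R. True \<and> True} = ?R" by auto
  have cR: "card ?R = w * (CARD('a) * t) * (CARD('a) * t)"
    using c[of "\<lambda>_ _. True" "\<lambda>_ _. True"] unfolding all R_eq by blast
  have "?R \<inter> noncoprime_at \<gamma> = {(f, g) \<in> ?R. ?nc (specialize_y f \<gamma>) (specialize_y g \<gamma>) \<and> True}"
    by (auto simp: noncoprime_at_def)
  then have c1: "card (?R \<inter> noncoprime_at \<gamma>) = w * t * (CARD('a) * t)"
    using c[of ?nc "\<lambda>_ _. True"] unfolding all nc
    by (simp only: coprime_smult_left_iff coprime_smult_right_iff not_False_eq_True simp_thms)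
  have "?R \<inter> (noncoprime_at \<gamma> \<inter> noncoprime_at \<delta>) = {(f, g) \<in> ?R.
      ?nc (specialize_y f \<gamma>) (specialize_y g \<gamma>) \<and> ?nc (specialize_y f \<delta>) (specialize_y g \<delta>)}"
    by (auto simp: noncoprime_at_def)
  then have c2: "card (?R \<inter> (noncoprime_at \<gamma> \<inter> noncoprime_at \<delta>)) = w * t * t"
    using c[of ?nc ?nc] unfolding nc
    by (simp only: coprime_smult_left_iff coprime_smult_right_iff not_False_eq_True simp_thms)
  \<comment> \<open>The size of \<open>vanishing_polys\<close> is never computed: \<open>w\<close>
    cancels, and it is nonzero because the sample space is nonempty.\<close>
  have "card ?R \<noteq> 0" using R by (simp only: card_eq_0_iff) simp
  then have "w \<noteq> 0" "t \<noteq> 0" unfolding cR by auto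
  then show "measure_pmf.prob (random_pair n m) (noncoprime_at \<gamma>) = 1 / ?q"
    "measure_pmf.prob (random_pair n m) (noncoprime_at \<gamma> \<inter> noncoprime_at \<delta>) = 1 / ?q ^ 2"
    unfolding prob cR c1 c2 by (simp_all add: power2_eq_square)
qed

section \<open>Mean and variance\<close>

theorem theorem2:
  fixes n m :: nat
    and P :: "('a::{field,finite} poly poly \<times> 'a poly poly) pmf"
    and X :: "'a poly poly \<times> 'a poly poly \<Rightarrow> real"
  assumes "n > 0" and "m > 0"
  defines "P \<equiv> random_pair n m"
    and "X \<equiv> \<lambda>(f, g). real (noncoprime_count f g)"
  shows "measure_pmf.expectation P X = 1 \<and> measure_pmf.variance P X = 1 - 1 / real CARD('a)"
proof -
  let ?q = "real CARD('a)"
  let ?I = "\<lambda>\<gamma>. indicat_real (noncoprime_at (\<gamma> :: 'a))"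
  have fin: "finite (set_pmf P)"
    unfolding P_def random_pair_def
    by (subst set_pmf_of_set) (auto simp: finite_x_regular_polys x_regular_polys_nonempty)
  note int = integrable_measure_pmf_finite[OF fin]
  have X: "X = (\<lambda>\<omega>. \<Sum>\<gamma>\<in>UNIV. ?I \<gamma> \<omega>)"
    by (auto simp: X_def noncoprime_count_def noncoprime_at_def indicator_def fun_eq_iff
        sum.If_cases Collect_conj_eq)
  have E1: "measure_pmf.expectation P (?I \<gamma>) = 1 / ?q" for \<gamma>
  proof -
    \<comment> \<open>The one-point probability was derived with the help of a second point; a field
      has one, as 0 and 1 differ.\<close>
    obtain \<delta> :: 'a where "\<gamma> \<noteq> \<delta>" by (metis zero_neq_one)
    then show ?thesis using prob_noncoprime_at(1)[OF assms(1,2)] by (simp add: P_def)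
  qed
  \<comment> \<open>On the diagonal the product is the indicator itself; off it, the product is the
    indicator of the intersection.\<close>
  have E2: "measure_pmf.expectation P (\<lambda>\<omega>. ?I \<gamma> \<omega> * ?I \<delta> \<omega>) =
      (if \<gamma> = \<delta> then 1 / ?q else 1 / ?q ^ 2)" for \<gamma> \<delta>
    using prob_noncoprime_at(2)[OF assms(1,2)] E1[of \<gamma>]
    by (auto simp: P_def indicator_inter_arith[symmetric])
  have q: "1 < ?q" using card_field_gt_1[where 'a = 'a] by simp
  have EX: "measure_pmf.expectation P X = 1"
    unfolding X using q by (subst Bochner_Integration.integral_sum) (simp_all only: int E1, simp)
  have "measure_pmf.expectation P (\<lambda>\<omega>. (X \<omega>)\<^sup>2) =
      (\<Sum>\<gamma>\<in>UNIV. \<Sum>\<delta>\<in>UNIV. measure_pmf.expectation P (\<lambda>\<omega>. ?I \<gamma> \<omega> * ?I \<delta> \<omega>))"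
    by (simp only: X power2_eq_square sum_product Bochner_Integration.integral_sum int)
  \<comment> \<open>Each \<open>\<gamma>\<close> contributes one diagonal term and
    \<open>q - 1\<close> off-diagonal terms.\<close>
  also have "\<dots> = (\<Sum>\<gamma>\<in>(UNIV :: 'a set). 1 / ?q + (?q - 1) / ?q ^ 2)"
  proof (rule sum.cong)
    fix \<gamma> :: 'a
    have "(\<Sum>\<delta>\<in>UNIV. if \<gamma> = \<delta> then 1 / ?q else 1 / ?q ^ 2) =
        1 / ?q + (\<Sum>\<delta>\<in>UNIV - {\<gamma>}. if \<gamma> = \<delta> then 1 / ?q else 1 / ?q ^ 2)"
      by (subst sum.remove[of _ \<gamma>]) auto
    also have "(\<Sum>\<delta>\<in>UNIV - {\<gamma>}. if \<gamma> = \<delta> then 1 / ?q else 1 / ?q ^ 2) = (\<Sum>\<delta>\<in>UNIV - {\<gamma>}. 1 / ?q ^ 2)"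
      by (rule sum.cong) auto
    also have "\<dots> = (?q - 1) / ?q ^ 2"
      using q by (simp add: card_Diff_singleton of_nat_diff)
    finally show "(\<Sum>\<delta>\<in>UNIV. measure_pmf.expectation P (\<lambda>\<omega>. ?I \<gamma> \<omega> * ?I \<delta> \<omega>)) =
        1 / ?q + (?q - 1) / ?q ^ 2"
      by (simp only: E2)
  qed simp
  also have "\<dots> = 2 - 1 / ?q"
    using q by (simp add: field_simps power2_eq_square)
  finally show ?thesis
    using EX by (subst measure_pmf.variance_eq) (simp_all add: int)
qed

end
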